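(* Let $G=(V,E,w)$ be an undirected graph on $n$ vertices with non-negative edge weights, and let $k>1$ be an integer. Then there exists a weighted graph $H$ on vertex set $V$ with at most $O(kn+n^{1+1/(2^k-1)})$ edges which, for every $0<\varepsilon<1$ simultaneously, is a $(1+\varepsilon,\beta\cdot W)$-emulator of $G$ with $\beta=O(k/\varepsilon)^{k-1}$; that is, for every $0<\varepsilon<1$ and all $x,y\in V$, \[ d_G(x,y)\le d_H(x,y)\le (1+\varepsilon)\,d_G(x,y)+\beta\cdot W(x,y), \qquad \beta\le (Ck/\varepsilon)^{k-1}\] for an absolute constant $C$.
   Context: $d_G$ and $d_H$ denote shortest-path distances in $G$ and in $H$ respectively. For $x,y\in V$, $W(x,y)=\max\{w(e): e\in P_{xy}\}$, where $P_{xy}$ is a shortest path from $x$ to $y$ in $G$. *)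

theory Defs
  imports "Graph_Theory.Pair_Digraph" "Graph_Theory.Shortest_Path"
begin

text \<open>
  As in Graph_Theory, a finite simple undirected graph is a symmetric loop-free digraph
  (locale \<open>pair_graph\<close>): an edge \<open>{u, v}\<close> is represented by the two arcs \<open>(u, v)\<close>
  and \<open>(v, u)\<close>, which therefore have to carry the same weight.
\<close>

definition weighted_graph :: "'a pair_pre_digraph \<Rightarrow> ('a \<times> 'a) weight_fun \<Rightarrow> bool" where
  "weighted_graph G w \<longleftrightarrow>
     pair_graph G \<and> (\<forall>(u, v) \<in> parcs G. 0 \<le> w (u, v) \<and> w (u, v) = w (v, u))"

text \<open>Undirected edges: the two arcs \<open>(u, v)\<close> and \<open>(v, u)\<close> count once.\<close>

definition undirected_edges :: "'a pair_pre_digraph \<Rightarrow> 'a set set" where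
  "undirected_edges G = (\<lambda>(u, v). {u, v}) ` parcs G"

text \<open>The value is \<open>\<infinity>\<close> if \<open>x\<close> and \<open>y\<close> are not connected.\<close>

definition graph_dist ::
    "'a pair_pre_digraph \<Rightarrow> ('a \<times> 'a) weight_fun \<Rightarrow> 'a \<Rightarrow> 'a \<Rightarrow> ereal" where
  "graph_dist G w x y = wf_digraph.\<mu> (with_proj G) w x y"

definition shortest_path ::
    "'a pair_pre_digraph \<Rightarrow> ('a \<times> 'a) weight_fun \<Rightarrow> 'a \<Rightarrow> ('a \<times> 'a) awalk \<Rightarrow> 'a \<Rightarrow> bool" where
  "shortest_path G w x p y \<longleftrightarrow>
     pre_digraph.apath (with_proj G) x p y \<and>
     ereal (wf_digraph.awalk_cost w p) = graph_dist G w x y"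

text \<open>
  A choice of one shortest path \<open>P x y\<close> for every connected pair. Nothing is required of
  \<open>P x y\<close> if \<open>x\<close> and \<open>y\<close> are not connected.
\<close>

definition shortest_path_choice ::
    "'a pair_pre_digraph \<Rightarrow> ('a \<times> 'a) weight_fun \<Rightarrow> ('a \<Rightarrow> 'a \<Rightarrow> ('a \<times> 'a) awalk) \<Rightarrow> bool" where
  "shortest_path_choice G w P \<longleftrightarrow>
     (\<forall>x \<in> pverts G. \<forall>y \<in> pverts G. x \<rightarrow>\<^sup>*\<^bsub>with_proj G\<^esub> y \<longrightarrow> shortest_path G w x (P x y) y)"

text \<open>
  The \<open>0\<close> only matters for the empty path, that is, for \<open>x = y\<close>, since weights of
  edges are non-negative.
\<close>

definition max_edge_weight ::
    "('a \<times> 'a) weight_fun \<Rightarrow> ('a \<Rightarrow> 'a \<Rightarrow> ('a \<times> 'a) awalk) \<Rightarrow> 'a \<Rightarrow> 'a \<Rightarrow> real" where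
  "max_edge_weight w P x y = Max (insert 0 (w ` set (P x y)))"

text \<open>
  The additive term \<open>b\<close> may depend on the pair of vertices. For a pair that is not connected in
  \<open>G\<close>, the lower bound says that it is not connected in \<open>H\<close>, and the upper bound holds
  trivially.
\<close>

definition is_emulator ::
    "real \<Rightarrow> ('a \<Rightarrow> 'a \<Rightarrow> real) \<Rightarrow> 'a pair_pre_digraph \<Rightarrow> ('a \<times> 'a) weight_fun \<Rightarrow>
     'a pair_pre_digraph \<Rightarrow> ('a \<times> 'a) weight_fun \<Rightarrow> bool" where
  "is_emulator \<alpha> b G w H wH \<longleftrightarrow>
     weighted_graph H wH \<and> pverts H = pverts G \<and>
     (\<forall>x \<in> pverts G. \<forall>y \<in> pverts G.
        graph_dist G w x y \<le> graph_dist H wH x y \<and>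
        graph_dist H wH x y \<le> ereal \<alpha> * graph_dist G w x y + ereal (b x y))"

end

theory Submission
  imports Defs
begin

text \<open>
  The emulator is the one of Thorup and Zwick. Take sets \<open>V = A\<^sub>0 \<supseteq> A\<^sub>1 \<supseteq> \<dots> \<supseteq> A\<^sub>k = \<emptyset>\<close>, where
  \<open>A\<^sub>i\<close> has at most \<open>n powr (1 - (2^i - 1)\<nu>) / 2^i\<close> elements, \<open>\<nu> = 1 / (2^k - 1)\<close>. Join every vertex
  to its nearest vertex in each \<open>A\<^sub>i\<close>, and every \<open>u \<in> A\<^sub>i\<close> to those \<open>v \<in> A\<^sub>i\<close> that are closer to \<open>u\<close>
  than all of \<open>A\<^sub>i\<^sub>+\<^sub>1\<close>; a good choice of \<open>A\<^sub>i\<^sub>+\<^sub>1\<close> creates at most \<open>2 n powr (1 + \<nu>) / 2^i\<close> edges of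
  the second kind, which sums to \<open>O(n powr (1 + \<nu>))\<close> without a factor \<open>k\<close>.

  For the stretch, induction on \<open>i\<close> shows that for every walk from \<open>u\<close> to \<open>v\<close> either \<open>H\<close> already
  approximates its cost, or \<open>H\<close> has a short path from \<open>u\<close> to \<open>A\<^sub>i\<^sub>+\<^sub>1\<close>. In the step, the walk is cut
  into about \<open>k/\<epsilon>\<close> segments. If not all of them are approximated, the first and the last bad one
  have hubs \<open>z, z' \<in> A\<^sub>i\<^sub>+\<^sub>1\<close> nearby, and either \<open>z z'\<close> is an edge of \<open>H\<close> or \<open>z\<close> has a nearby vertex of
  \<open>A\<^sub>i\<^sub>+\<^sub>2\<close>. Since \<open>A\<^sub>k\<close> is empty, the first alternative holds at level \<open>k - 1\<close>. The emulator does
  not depend on \<open>\<epsilon>\<close>.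
\<close>

subsection \<open>Distances in weighted graphs\<close>

locale weighted_pair_graph = pair_graph G for G :: "'a pair_pre_digraph" +
  fixes w :: "('a \<times> 'a) weight_fun"
  assumes weight_nonneg: "e \<in> parcs G \<Longrightarrow> 0 \<le> w e"
    and weight_sym: "(u, v) \<in> parcs G \<Longrightarrow> w (u, v) = w (v, u)"
begin

abbreviation gdist :: "'a \<Rightarrow> 'a \<Rightarrow> ereal" where
  "gdist \<equiv> graph_dist G w"

lemma gdist_le_cost: "awalk u p v \<Longrightarrow> gdist u v \<le> ereal (awalk_cost w p)"
  unfolding graph_dist_def by (rule min_cost_le_walk_cost)

lemma cost_nonneg: "awalk u p v \<Longrightarrow> 0 \<le> awalk_cost w p"
  by (rule pos_cost_pos_awalk_cost[OF _ weight_nonneg])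

lemma gdist_nonneg: "0 \<le> gdist u v"
  unfolding graph_dist_def \<mu>_def by (rule INF_greatest) (auto intro: cost_nonneg)

lemma gdist_self: "u \<in> pverts G \<Longrightarrow> gdist u u = 0"
  using gdist_le_cost[of u "[]" u] gdist_nonneg[of u u] by (simp add: awalk_Nil_iff zero_ereal_def)

lemma gdist_attained:
  assumes "gdist u v \<noteq> \<infinity>"
  obtains p where "awalk u p v" "gdist u v = ereal (awalk_cost w p)"
proof -
  have "u \<rightarrow>\<^sup>*\<^bsub>with_proj G\<^esub> v"
    using assms \<mu>_reach_conv[of w u v] unfolding graph_dist_def by simp
  with min_cost_awalk[of u v w] weight_nonneg that show thesis
    unfolding graph_dist_def by (auto simp: apath_def)
qed

lemma gdist_triangle: "gdist u x \<le> gdist u v + gdist v x"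
proof (cases "gdist u v = \<infinity> \<or> gdist v x = \<infinity>")
  case True
  then show ?thesis using gdist_nonneg[of u v] gdist_nonneg[of v x] by auto
next
  case False
  then obtain p q where "awalk u p v" "gdist u v = ereal (awalk_cost w p)"
    and "awalk v q x" "gdist v x = ereal (awalk_cost w q)"
    by (metis gdist_attained)
  then show ?thesis
    using gdist_le_cost[of u "p @ q" x] by (auto intro: awalk_appendI)
qed

lemma cost_rev_path:
  assumes "awalk u p v"
  shows "awalk_cost w (rev_path p) = awalk_cost w p"
  using assms
proof (induct p arbitrary: u)
  case (Cons e es)
  then show ?case by (cases e) (auto simp: awalk_Cons_iff dest: weight_sym)
qed simp

lemma gdist_sym: "gdist u v = gdist v u"
proof -
  have "gdist v u \<le> gdist u v" for u v
  proof (cases "gdist u v = \<infinity>")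
    case False
    then obtain p where "awalk u p v" "gdist u v = ereal (awalk_cost w p)"
      by (rule gdist_attained)
    then show ?thesis
      using gdist_le_cost[of v "rev_path p" u] cost_rev_path by auto
  qed simp
  then show ?thesis by (metis antisym)
qed

end

lemma weighted_graph_iff: "weighted_graph G w \<longleftrightarrow> weighted_pair_graph G w"
proof
  show "weighted_graph G w \<Longrightarrow> weighted_pair_graph G w"
    unfolding weighted_graph_def
    by (intro weighted_pair_graph.intro weighted_pair_graph_axioms.intro) auto
next
  assume "weighted_pair_graph G w"
  then interpret weighted_pair_graph G w .
  show "weighted_graph G w"
    unfolding weighted_graph_def using weight_nonneg weight_sym by auto
qed

section \<open>Graphs whose edges carry exact distances of \<open>G\<close>\<close>

text \<open>\<open>X\<close> is a mere list of requests: symmetrising it and dropping loops and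
  disconnected pairs here makes every set of ordered pairs admissible.\<close>

definition distance_graph ::
    "'a pair_pre_digraph \<Rightarrow> ('a \<times> 'a) weight_fun \<Rightarrow> ('a \<times> 'a) set \<Rightarrow> 'a pair_pre_digraph" where
  "distance_graph G w X =
     \<lparr>pverts = pverts G,
      parcs = {(u, v). u \<in> pverts G \<and> v \<in> pverts G \<and> u \<noteq> v \<and> graph_dist G w u v \<noteq> \<infinity> \<and>
                 ((u, v) \<in> X \<or> (v, u) \<in> X)}\<rparr>"

lemma pverts_distance_graph [simp]: "pverts (distance_graph G w X) = pverts G"
  by (simp add: distance_graph_def)

text \<open>\<open>real_of_ereal\<close> turns \<infinity> into 0, which is harmless because arcs of
  \<open>distance_graph\<close> only join vertices at finite distance.\<close>

definition distance_weight ::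
    "'a pair_pre_digraph \<Rightarrow> ('a \<times> 'a) weight_fun \<Rightarrow> ('a \<times> 'a) weight_fun" where
  "distance_weight G w = (\<lambda>(u, v). real_of_ereal (graph_dist G w u v))"

lemma card_undirected_edges_distance_graph:
  assumes "finite X"
  shows "card (undirected_edges (distance_graph G w X)) \<le> card X"
proof -
  have "undirected_edges (distance_graph G w X) \<subseteq> (\<lambda>(u, v). {u, v}) ` X"
    unfolding undirected_edges_def distance_graph_def by force
  then have "card (undirected_edges (distance_graph G w X)) \<le> card ((\<lambda>(u, v). {u, v}) ` X)"
    using assms by (intro card_mono) auto
  also have "\<dots> \<le> card X" using assms by (rule card_image_le)
  finally show ?thesis .
qed

context weighted_pair_graph
begin

lemma distance_weight_eq:
  "gdist u v \<noteq> \<infinity> \<Longrightarrow> ereal (distance_weight G w (u, v)) = gdist u v"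
  using gdist_nonneg[of u v] unfolding distance_weight_def by (cases "gdist u v") auto

lemma weighted_pair_graph_distance_graph:
  "weighted_pair_graph (distance_graph G w X) (distance_weight G w)"
proof
  show "finite (parcs (distance_graph G w X))"
    by (rule finite_subset[of _ "pverts G \<times> pverts G"]) (auto simp: distance_graph_def)
  show "symmetric (with_proj (distance_graph G w X))"
    by (auto simp: symmetric_def distance_graph_def gdist_sym intro!: symI)
qed (auto simp: distance_graph_def distance_weight_def gdist_sym real_of_ereal_pos gdist_nonneg)

text \<open>Each arc weighs exactly the distance of its ends, so the triangle inequality, applied
  arc by arc along a walk, gives the lower bound of the emulator for every \<open>X\<close>.\<close>

lemma gdist_le_distance_graph:
  "gdist x y \<le> graph_dist (distance_graph G w X) (distance_weight G w) x y"
proof -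
  interpret H: weighted_pair_graph "distance_graph G w X" "distance_weight G w"
    by (rule weighted_pair_graph_distance_graph)
  have "gdist x y \<le> ereal (H.awalk_cost (distance_weight G w) p)" if "H.awalk x p y" for p
    using that
  proof (induct p arbitrary: x)
    case Nil
    then have "x = y" "x \<in> pverts G"
      by (auto simp: H.awalk_Nil_iff)
    then show ?case by (simp add: gdist_self)
  next
    case (Cons e p)
    obtain v where e: "e = (x, v)" and arc: "(x, v) \<in> parcs (distance_graph G w X)" and "H.awalk v p y"
      using Cons.prems by (cases e) (auto simp: H.awalk_Cons_iff)
    have "gdist x y \<le> gdist x v + gdist v y" by (rule gdist_triangle)
    also have "gdist x v = ereal (distance_weight G w e)"
      using arc by (simp add: e distance_weight_eq distance_graph_def)
    also have "gdist v y \<le> ereal (H.awalk_cost (distance_weight G w) p)"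
      by (rule Cons.hyps) fact
    finally show ?case by (simp add: add_left_mono)
  qed
  then show ?thesis
    unfolding graph_dist_def[of "distance_graph G w X"] H.\<mu>_def by (auto intro: INF_greatest)
qed

lemma distance_graph_le_gdist:
  assumes "u \<in> pverts G" "v \<in> pverts G" "(u, v) \<in> X"
  shows "graph_dist (distance_graph G w X) (distance_weight G w) u v \<le> gdist u v"
proof -
  interpret H: weighted_pair_graph "distance_graph G w X" "distance_weight G w"
    by (rule weighted_pair_graph_distance_graph)
  consider "gdist u v = \<infinity>" | "u = v" | "gdist u v \<noteq> \<infinity>" "u \<noteq> v" by blast
  then show ?thesis
  proof cases
    case 2
    then show ?thesis using assms H.gdist_self[of u] gdist_nonneg by simp
  next
    case 3
    then have "(u, v) \<in> parcs (distance_graph G w X)"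
      using assms by (simp add: distance_graph_def)
    then have "H.awalk u [(u, v)] v"
      by (auto simp: H.awalk_simps dest: H.in_arcsD1 H.in_arcsD2)
    from H.gdist_le_cost[OF this] show ?thesis
      using 3 by (simp add: distance_weight_eq)
  qed simp
qed

end

subsection \<open>Sampling by averaging\<close>

text \<open>
  Averaging over all \<open>S\<close> with \<open>card S = s\<close>: for fixed \<open>u\<close>, a pair \<open>(S, v)\<close> with \<open>v\<close> strictly closer
  to \<open>u\<close> than all of \<open>S\<close> is determined by \<open>insert v S\<close>, so there are at most
  \<open>card A choose Suc s\<close> of them.
\<close>

lemma sum_card_strictly_closer_le:
  fixes f :: "'a \<Rightarrow> 'b :: linorder"
  assumes "finite A"
  shows "(\<Sum>S | S \<subseteq> A \<and> card S = s. card {v \<in> A. \<forall>a\<in>S. f v < f a}) \<le> card A choose Suc s"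
proof -
  define Q where "Q = (SIGMA S : {S. S \<subseteq> A \<and> card S = s}. {v \<in> A. \<forall>a\<in>S. f v < f a})"
  have fin: "finite {S. S \<subseteq> A \<and> card S = s}" using assms by simp
  have notin: "v \<notin> S" if "(S, v) \<in> Q" for S v
    using that by (auto simp: Q_def)
  have inj: "inj_on (\<lambda>(S, v). insert v S) Q"
  proof (rule inj_onI, clarify)
    fix S v T x
    assume Q: "(S, v) \<in> Q" "(T, x) \<in> Q" and eq: "insert v S = insert x T"
    \<comment> \<open>If they differed, each would lie in the other's set, giving both
      \<open>f v < f x\<close> and \<open>f x < f v\<close>: the added element is the strict
      \<open>f\<close>-minimum of the union.\<close>
    have "v = x"
    proof (rule ccontr)
      assume "v \<noteq> x"
      then have "v \<in> T" "x \<in> S" using eq by auto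
      then show False using Q by (force simp: Q_def)
    qed
    then show "S = T \<and> v = x" using eq notin[OF Q(1)] notin[OF Q(2)] by (simp add: insert_ident)
  qed
  have sub: "(\<lambda>(S, v). insert v S) ` Q \<subseteq> {S. S \<subseteq> A \<and> card S = Suc s}"
  proof clarify
    fix S v assume Sv: "(S, v) \<in> Q"
    then have "finite S" using assms by (auto simp: Q_def intro: finite_subset)
    then show "insert v S \<subseteq> A \<and> card (insert v S) = Suc s"
      using Sv notin[OF Sv] by (auto simp: Q_def)
  qed
  have "(\<Sum>S | S \<subseteq> A \<and> card S = s. card {v \<in> A. \<forall>a\<in>S. f v < f a}) = card Q"
    unfolding Q_def using fin assms by (subst card_SigmaI) auto
  also have "\<dots> \<le> card {S. S \<subseteq> A \<and> card S = Suc s}"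
    using inj sub assms by (intro card_inj_on_le) auto
  also have "\<dots> = card A choose Suc s"
    using assms by (rule n_subsets)
  finally show ?thesis .
qed

text \<open>Over all \<open>S\<close> of size \<open>s\<close>, the average number of pairs is at
  most \<open>m * (m choose Suc s) / (m choose s) = m * (m - s) / (s + 1)\<close>, hence at most
  \<open>m^2 / N\<close> when \<open>N < s + 1\<close>.\<close>

lemma exists_subset_few_strictly_closer:
  fixes f :: "'a \<Rightarrow> 'a \<Rightarrow> 'b :: linorder"
  assumes "finite A" "0 < N"
  shows "\<exists>S\<subseteq>A. real (card S) \<le> N \<and>
    real (\<Sum>u\<in>A. card {v \<in> A. \<forall>a\<in>S. f u v < f u a}) \<le> (real (card A))\<^sup>2 / N"
proof (cases "real (card A) \<le> N")
  case True
  have "{v \<in> A. \<forall>a\<in>A. f u v < f u a} = {}" for u by force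
  then show ?thesis using True assms by (intro exI[of _ A]) (simp only:, simp)
next
  case False
  define m where "m = card A"
  \<comment> \<open>For \<open>N < 1\<close> this is 0 and \<open>S\<close> is empty; all
    \<open>m^2\<close> pairs then count, still within \<open>m^2 / N\<close>.\<close>
  define s where "s = nat \<lfloor>N\<rfloor>"
  have s: "real s \<le> N" "N < real s + 1"
    using \<open>0 < N\<close> unfolding s_def by linarith+
  with False have "s \<le> m" by (simp add: m_def)
  define F where "F = {S. S \<subseteq> A \<and> card S = s}"
  define g where "g S = (\<Sum>u\<in>A. card {v \<in> A. \<forall>a\<in>S. f u v < f u a})" for S
  have card_F: "card F = m choose s"
    unfolding F_def m_def using assms by (intro n_subsets)
  have "(\<Sum>S\<in>F. g S) = (\<Sum>u\<in>A. \<Sum>S\<in>F. card {v \<in> A. \<forall>a\<in>S. f u v < f u a})"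
    unfolding g_def by (rule sum.swap)
  also have "\<dots> \<le> (\<Sum>u\<in>A. m choose Suc s)"
    unfolding F_def m_def by (intro sum_mono sum_card_strictly_closer_le assms)
  finally have total: "(\<Sum>S\<in>F. g S) \<le> m * (m choose Suc s)" by (simp add: m_def)
  have "\<exists>S\<in>F. Suc s * g S \<le> m * m"
  proof (rule ccontr)
    assume "\<not> ?thesis"
    then have less: "m * m < Suc s * g S" if "S \<in> F" for S using that by auto
    have "card F * (m * m) < (\<Sum>S\<in>F. Suc s * g S)"
    proof -
      have "0 < card F" using card_F \<open>s \<le> m\<close> by simp
      then have "finite F" "F \<noteq> {}" by (auto simp: card_gt_0_iff)
      then have "(\<Sum>S\<in>F. m * m) < (\<Sum>S\<in>F. Suc s * g S)"
        using less by (intro sum_strict_mono) auto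
      then show ?thesis by simp
    qed
    also have "\<dots> \<le> Suc s * (m * (m choose Suc s))"
      using total by (simp only: sum_distrib_left[symmetric] mult_le_mono2)
    also have "\<dots> = m * ((m - s) * (m choose s))"
    proof -
      have "Suc s * (m choose Suc s) = (m - s) * (m choose s)"
        using binomial_absorb_comp[of m s] binomial_absorption[of s m] by simp
      then show ?thesis by (metis mult.left_commute)
    qed
    also have "\<dots> \<le> card F * (m * m)"
      by (simp add: card_F)
    finally show False by simp
  qed
  then obtain S where S: "S \<in> F" "Suc s * g S \<le> m * m" by blast
  have "N * real (g S) \<le> (real s + 1) * real (g S)"
    using s by (intro mult_right_mono) auto
  also have "\<dots> = real (Suc s * g S)" by (simp add: algebra_simps)
  also have "\<dots> \<le> (real m)\<^sup>2"
    using S(2) by (simp add: power2_eq_square flip: of_nat_mult)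
  finally have "real (g S) \<le> (real m)\<^sup>2 / N"
    using \<open>0 < N\<close> by (simp add: field_simps)
  then show ?thesis
    using S(1) s(1) by (intro exI[of _ S]) (simp add: F_def g_def m_def)
qed

subsection \<open>Stretch\<close>

text \<open>The prefix stops as soon as its sum exceeds \<open>D\<close>, so it overshoots by at
  most one element, that is, by at most \<open>W\<close>.\<close>

lemma exists_prefix_sum_list:
  fixes f :: "'b \<Rightarrow> real"
  assumes "\<forall>e\<in>set p. f e \<le> W" "0 \<le> W" "0 \<le> D"
  shows "\<exists>p1 p2. p = p1 @ p2 \<and> sum_list (map f p1) \<le> D + W \<and>
    (p2 = [] \<or> D < sum_list (map f p1))"
  using assms(1)
proof (induct p rule: rev_induct)
  case Nil
  then show ?case using assms by simp
next
  case (snoc e p)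
  then obtain p1 p2 where p: "p = p1 @ p2" "sum_list (map f p1) \<le> D + W"
    and p2: "p2 = [] \<or> D < sum_list (map f p1)" by auto
  show ?case
  proof (cases "D < sum_list (map f p1)")
    case True
    then show ?thesis using p by (intro exI[of _ p1] exI[of _ "p2 @ [e]"]) simp
  next
    case False
    then show ?thesis using p p2 snoc.prems by (intro exI[of _ "p @ [e]"] exI[of _ "[]"]) auto
  qed
qed

text \<open>This isolates what the stretch argument needs of the emulator: \<open>dH\<close> behaves
  like a metric dominating \<open>gdist\<close>, and \<open>hub\<close> says that a pair of
  level-\<open>j\<close> hubs is either served directly or can be exchanged for a hub one level up
  at no greater distance.\<close>

locale hub_hierarchy = weighted_pair_graph G w
  for G :: "'a pair_pre_digraph" and w :: "('a \<times> 'a) weight_fun" +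
  fixes dH :: "'a \<Rightarrow> 'a \<Rightarrow> ereal" and A :: "nat \<Rightarrow> 'a set"
  assumes dH_sym: "dH u v = dH v u"
    and dH_triangle: "dH u x \<le> dH u v + dH v x"
    and dH_self: "u \<in> pverts G \<Longrightarrow> dH u u = 0"
    and gdist_le_dH: "gdist u v \<le> dH u v"
    and verts_hubs: "pverts G \<subseteq> A 0"
    and hub: "\<lbrakk>z \<in> A j; z' \<in> A j; gdist z z' \<le> ereal r\<rbrakk> \<Longrightarrow>
      dH z z' \<le> ereal r \<or> (\<exists>h\<in>A (Suc j). dH z h \<le> ereal r)"
begin

lemma dH_trans: "dH u v \<le> ereal a \<Longrightarrow> dH v x \<le> ereal b \<Longrightarrow> dH u x \<le> ereal (a + b)"
  using order_trans[OF dH_triangle add_mono[of "dH u v" "ereal a" "dH v x" "ereal b"]] by simp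

lemma gdist_trans: "gdist u v \<le> ereal a \<Longrightarrow> gdist v x \<le> ereal b \<Longrightarrow> gdist u x \<le> ereal (a + b)"
  using order_trans[OF gdist_triangle add_mono[of "gdist u v" "ereal a" "gdist v x" "ereal b"]]
  by simp

text \<open>The walk is cut greedily into segments, stopping before the first one that
  \<open>dH\<close> approximates badly. Every segment but the last costs more than \<open>D\<close>,
  so at most \<open>n + 1\<close> good ones occur, each adding \<beta> to the error.\<close>

lemma greedy_prefix:
  assumes "awalk u p v" "\<forall>e\<in>set p. w e \<le> W" "awalk_cost w p \<le> real n * D"
    and nonneg: "0 \<le> W" "0 \<le> D" "0 \<le> \<beta>"
  shows "\<exists>p1 x p2. p = p1 @ p2 \<and> awalk u p1 x \<and> awalk x p2 v \<and>
    dH u x \<le> ereal (\<alpha> * awalk_cost w p1 + (real n + 1) * \<beta>) \<and>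
    (p2 = [] \<or> (\<exists>q1 y q2. p2 = q1 @ q2 \<and> awalk x q1 y \<and> awalk_cost w q1 \<le> D + W \<and>
      \<not> dH x y \<le> ereal (\<alpha> * awalk_cost w q1 + \<beta>)))"
  using assms(1-3)
proof (induct n arbitrary: u p)
  case (0 u p)
  \<comment> \<open>With the budget exhausted, all that remains has cost at most 0 and forms a
    single last segment.\<close>
  have "awalk_cost w p \<le> D + W" using 0 nonneg by simp
  show ?case
  proof (cases "dH u v \<le> ereal (\<alpha> * awalk_cost w p + \<beta>)")
    case True
    then show ?thesis
      using 0 by (intro exI[of _ p] exI[of _ v] exI[of _ "[]"]) (auto simp: awalk_Nil_iff)
  next
    case False
    have "u \<in> pverts G" "v \<in> pverts G" using 0 by auto
    moreover from this have "\<exists>q1 y q2. p = q1 @ q2 \<and> awalk u q1 y \<and> awalk_cost w q1 \<le> D + W \<and>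
        \<not> dH u y \<le> ereal (\<alpha> * awalk_cost w q1 + \<beta>)"
      using 0 False \<open>awalk_cost w p \<le> D + W\<close>
      by (intro exI[of _ p] exI[of _ v] exI[of _ "[]"]) simp
    ultimately show ?thesis
      using 0 nonneg
      by (intro exI[of _ "[]"] exI[of _ u] exI[of _ p]) (simp add: awalk_Nil_iff dH_self)
  qed
next
  case (Suc n u p)
  obtain q1 q2 where p: "p = q1 @ q2" and q1: "awalk_cost w q1 \<le> D + W"
    and q2: "q2 = [] \<or> D < awalk_cost w q1"
    using exists_prefix_sum_list[OF Suc.prems(2) nonneg(1,2)] by (auto simp: awalk_cost_def)
  obtain y where walks: "awalk u q1 y" "awalk y q2 v"
    using Suc.prems(1) by (auto simp: p)
  show ?case
  proof (cases "dH u y \<le> ereal (\<alpha> * awalk_cost w q1 + \<beta>)")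
    case good: True
    show ?thesis
    proof (cases "q2 = []")
      case True
      have "\<beta> \<le> (real (Suc n) + 1) * \<beta>" using nonneg by (simp add: algebra_simps)
      then have "dH u y \<le> ereal (\<alpha> * awalk_cost w q1 + (real (Suc n) + 1) * \<beta>)"
        using order_trans[OF good] by simp
      then show ?thesis using True walks p by (intro exI[of _ q1] exI[of _ y] exI[of _ q2]) simp
    next
      case False
      have light: "\<forall>e\<in>set q2. w e \<le> W" using Suc.prems(2) by (simp add: p)
      from False have "awalk_cost w q2 \<le> real n * D"
        using Suc.prems(3) q2 by (simp add: p algebra_simps)
      then obtain p1 x p2 where IH: "q2 = p1 @ p2" "awalk y p1 x" "awalk x p2 v"
        "dH y x \<le> ereal (\<alpha> * awalk_cost w p1 + (real n + 1) * \<beta>)"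
        "p2 = [] \<or> (\<exists>q1 y q2. p2 = q1 @ q2 \<and> awalk x q1 y \<and> awalk_cost w q1 \<le> D + W \<and>
          \<not> dH x y \<le> ereal (\<alpha> * awalk_cost w q1 + \<beta>))"
        using Suc.hyps[OF walks(2) light] by blast
      have "dH u x \<le> ereal (\<alpha> * awalk_cost w (q1 @ p1) + (real (Suc n) + 1) * \<beta>)"
        using dH_trans[OF good IH(4)] by (simp add: algebra_simps)
      then show ?thesis
        using IH walks p
        by (intro exI[of _ "q1 @ p1"] exI[of _ x] exI[of _ p2]) (auto intro: awalk_appendI)
    qed
  next
    case False
    have "u \<in> pverts G" using Suc.prems by auto
    then show ?thesis
      using Suc.prems False nonneg q1 walks p
      by (intro exI[of _ "[]"] exI[of _ u] exI[of _ p])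
        (auto simp: awalk_Nil_iff dH_self)
  qed
qed

section \<open>Induction over the levels of the hierarchy\<close>

text \<open>The induction invariant. It speaks of all walks with edges of weight at most a fixed
  \<open>W\<close>, not of shortest paths, so that it applies to segments and to reversed walks with
  the same \<open>W\<close>.\<close>

definition stretch_or_hub :: "nat \<Rightarrow> real \<Rightarrow> real \<Rightarrow> real \<Rightarrow> real \<Rightarrow> real \<Rightarrow> bool" where
  "stretch_or_hub i W \<alpha> \<beta> \<gamma> \<zeta> \<longleftrightarrow>
     (\<forall>u p v. awalk u p v \<longrightarrow> (\<forall>e\<in>set p. w e \<le> W) \<longrightarrow>
        dH u v \<le> ereal (\<alpha> * awalk_cost w p + \<beta>) \<or>
        (\<exists>h\<in>A (Suc i). dH u h \<le> ereal (\<gamma> * awalk_cost w p + \<zeta>)))"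

lemma stretch_or_hub_mono:
  assumes "stretch_or_hub i W \<alpha> \<beta> \<gamma> \<zeta>" "\<alpha> \<le> \<alpha>'" "\<beta> \<le> \<beta>'" "\<gamma> \<le> \<gamma>'" "\<zeta> \<le> \<zeta>'"
  shows "stretch_or_hub i W \<alpha>' \<beta>' \<gamma>' \<zeta>'"
  unfolding stretch_or_hub_def
proof (intro allI impI)
  fix u p v assume walk: "awalk u p v" and light: "\<forall>e\<in>set p. w e \<le> W"
  let ?c = "awalk_cost w p"
  have "\<alpha> * ?c + \<beta> \<le> \<alpha>' * ?c + \<beta>'" "\<gamma> * ?c + \<zeta> \<le> \<gamma>' * ?c + \<zeta>'"
    using assms cost_nonneg[OF walk] by (intro add_mono mult_right_mono; simp)+
  moreover have "dH u v \<le> ereal (\<alpha> * ?c + \<beta>) \<or> (\<exists>h\<in>A (Suc i). dH u h \<le> ereal (\<gamma> * ?c + \<zeta>))"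
    using assms(1) walk light unfolding stretch_or_hub_def by blast
  ultimately show "dH u v \<le> ereal (\<alpha>' * ?c + \<beta>') \<or>
      (\<exists>h\<in>A (Suc i). dH u h \<le> ereal (\<gamma>' * ?c + \<zeta>'))"
    by (meson ereal_less_eq(3) order_trans)
qed

lemma stretch_or_hub_0: "stretch_or_hub 0 W 1 0 1 0"
  unfolding stretch_or_hub_def
proof (intro allI impI)
  fix u p v assume walk: "awalk u p v"
  then have "u \<in> A 0" "v \<in> A 0" using verts_hubs by auto
  then show "dH u v \<le> ereal (1 * awalk_cost w p + 0) \<or>
      (\<exists>h\<in>A (Suc 0). dH u h \<le> ereal (1 * awalk_cost w p + 0))"
    using hub[OF _ _ gdist_le_cost[OF walk]] by simp
qed

lemma light_rev_path:
  assumes "awalk u p v"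
  shows "(\<forall>e\<in>set (rev_path p). w e \<le> W) \<longleftrightarrow> (\<forall>e\<in>set p. w e \<le> W)"
  using assms
proof (induct p arbitrary: u)
  case (Cons e es)
  then show ?case by (cases e) (auto simp: awalk_Cons_iff dest: weight_sym)
qed simp

text \<open>Scanning from \<open>u\<close> and then backwards from \<open>v\<close>, each time up to
  the first bad segment, leaves a middle part from \<open>x\<close> to \<open>s\<close> with hubs
  \<open>z\<close> and \<open>z'\<close> near its ends. Either \<open>u, x, z, z', s, v\<close> is a
  good detour in \<open>dH\<close>, or \<open>hub\<close> supplies a higher hub near
  \<open>z\<close>.\<close>

lemma stretch_or_hub_Suc:
  assumes claim: "stretch_or_hub i W \<alpha> \<beta> \<gamma> \<zeta>"
    and "0 < n" "0 \<le> W" "1 \<le> \<alpha>" "0 \<le> \<beta>" "0 \<le> \<gamma>" "0 \<le> \<zeta>"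
  shows "stretch_or_hub (Suc i) W
    (\<alpha> + 4 * \<gamma> / real n) (2 * (real n + 1) * \<beta> + 4 * (\<gamma> * W + \<zeta>))
    (\<alpha> + 3 * \<gamma> / real n) (2 * (real n + 1) * \<beta> + 3 * (\<gamma> * W + \<zeta>))"
  unfolding stretch_or_hub_def
proof (intro allI impI)
  fix u p v assume walk: "awalk u p v" and light: "\<forall>e\<in>set p. w e \<le> W"
  define c where "c = awalk_cost w p"
  define D where "D = c / real n"
  \<comment> \<open>\<open>M\<close> bounds the distance from the start of a bad segment to its hub,
    and \<open>B\<close> the additive error of the good segments of one scan.\<close>
  define M where "M = \<gamma> * (D + W) + \<zeta>"
  define B where "B = (real n + 1) * \<beta>"
  have "0 \<le> c" unfolding c_def using walk by (rule cost_nonneg)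
  then have "0 \<le> D" and c_eq: "c = real n * D" using \<open>0 < n\<close> by (auto simp: D_def)
  have "0 \<le> M" "0 \<le> B" using assms \<open>0 \<le> D\<close> by (simp_all add: M_def B_def)
  have near_hub: "\<exists>h\<in>A (Suc i). dH x h \<le> ereal M"
    if near: "awalk x q y" "\<forall>e\<in>set q. w e \<le> W" "awalk_cost w q \<le> D + W"
      "\<not> dH x y \<le> ereal (\<alpha> * awalk_cost w q + \<beta>)" for x q y
  proof -
    obtain h where "h \<in> A (Suc i)" and h: "dH x h \<le> ereal (\<gamma> * awalk_cost w q + \<zeta>)"
      using claim near unfolding stretch_or_hub_def by blast
    moreover have "\<gamma> * awalk_cost w q + \<zeta> \<le> M"
      unfolding M_def using near assms by (intro add_right_mono mult_left_mono) auto
    ultimately show ?thesis by (meson ereal_less_eq(3) order_trans)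
  qed
  have "\<alpha> * c + 2 * B + 4 * M =
      (\<alpha> + 4 * \<gamma> / real n) * c + (2 * (real n + 1) * \<beta> + 4 * (\<gamma> * W + \<zeta>))"
    and "\<alpha> * c + 2 * B + 3 * M =
      (\<alpha> + 3 * \<gamma> / real n) * c + (2 * (real n + 1) * \<beta> + 3 * (\<gamma> * W + \<zeta>))"
    by (simp_all add: M_def D_def B_def algebra_simps)
  moreover have "dH u v \<le> ereal (\<alpha> * c + 2 * B + 4 * M) \<or>
      (\<exists>h\<in>A (Suc (Suc i)). dH u h \<le> ereal (\<alpha> * c + 2 * B + 3 * M))"
  proof -
    have "awalk_cost w p \<le> real n * D" using c_eq by (simp add: c_def)
    then obtain p1 x p2 where p: "p = p1 @ p2" and p1: "awalk u p1 x" and p2: "awalk x p2 v"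
      and ux: "dH u x \<le> ereal (\<alpha> * awalk_cost w p1 + B)"
      and left: "p2 = [] \<or> (\<exists>q1 y q2. p2 = q1 @ q2 \<and> awalk x q1 y \<and> awalk_cost w q1 \<le> D + W \<and>
        \<not> dH x y \<le> ereal (\<alpha> * awalk_cost w q1 + \<beta>))"
      using greedy_prefix[OF walk light _ \<open>0 \<le> W\<close> \<open>0 \<le> D\<close> \<open>0 \<le> \<beta>\<close>, of n \<alpha>]
      unfolding B_def by blast
    have c: "c = awalk_cost w p1 + awalk_cost w p2" by (simp add: c_def p)
    show ?thesis
    proof (cases "p2 = []")
      case True
      then have "dH u v \<le> ereal (\<alpha> * c + B)" using ux p2 by (simp add: c awalk_Nil_iff)
      then have "dH u v \<le> ereal (\<alpha> * c + 2 * B + 4 * M)"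
        by (rule order_trans) (use \<open>0 \<le> M\<close> \<open>0 \<le> B\<close> in simp)
      then show ?thesis ..
    next
      case False
      with left obtain z where z: "z \<in> A (Suc i)" "dH x z \<le> ereal M"
        using near_hub light unfolding p by (metis Un_iff set_append)
      \<comment> \<open>Only the remainder \<open>p2\<close> is scanned backwards, so the two good
        parts are disjoint and their costs and that of the middle part add up to
        \<open>c\<close>.\<close>
      have "awalk v (rev_path p2) x" using p2 by simp
      moreover have light': "\<forall>e\<in>set (rev_path p2). w e \<le> W"
        using light light_rev_path[OF p2] by (simp add: p)
      moreover have "awalk_cost w (rev_path p2) \<le> real n * D"
        using c_eq c cost_nonneg[OF p1] cost_rev_path[OF p2] by simp
      ultimately obtain r1 s r2 where r: "rev_path p2 = r1 @ r2"
        and r1: "awalk v r1 s" and r2: "awalk s r2 x"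
        and vs: "dH v s \<le> ereal (\<alpha> * awalk_cost w r1 + B)"
        and right: "r2 = [] \<or> (\<exists>q1 y q2. r2 = q1 @ q2 \<and> awalk s q1 y \<and> awalk_cost w q1 \<le> D + W \<and>
          \<not> dH s y \<le> ereal (\<alpha> * awalk_cost w q1 + \<beta>))"
        using greedy_prefix[of v "rev_path p2" x W n D \<beta> \<alpha>] \<open>0 \<le> W\<close> \<open>0 \<le> D\<close> \<open>0 \<le> \<beta>\<close>
        unfolding B_def by blast
      have c': "c = awalk_cost w p1 + awalk_cost w r1 + awalk_cost w r2"
        using cost_rev_path[OF p2] by (simp add: c r)
      have sv: "dH s v \<le> ereal (\<alpha> * awalk_cost w r1 + B)" using vs by (simp add: dH_sym)
      show ?thesis
      proof (cases "r2 = []")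
        case True
        then have "s = x" using r2 by (simp add: awalk_Nil_iff)
        with sv have "dH x v \<le> ereal (\<alpha> * awalk_cost w r1 + B)" by simp
        from dH_trans[OF ux this] True have "dH u v \<le> ereal (\<alpha> * c + 2 * B)"
          by (simp add: c' algebra_simps)
        then have "dH u v \<le> ereal (\<alpha> * c + 2 * B + 4 * M)"
          by (rule order_trans) (use \<open>0 \<le> M\<close> in simp)
        then show ?thesis ..
      next
        case False
        with right obtain z' where z': "z' \<in> A (Suc i)" "dH s z' \<le> ereal M"
          using near_hub light' unfolding r by (metis Un_iff set_append)
        define l where "l = awalk_cost w r2"
        have "0 \<le> l" unfolding l_def using r2 by (rule cost_nonneg)
        \<comment> \<open>The middle part is crossed at its exact cost \<open>l\<close>, which the
          multiplicative stretch already pays for; only multiples of \<open>M\<close> are left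
          over.\<close>
        then have "l \<le> \<alpha> * l" using \<open>1 \<le> \<alpha>\<close> by (simp add: mult_le_cancel_right1)
        have zx: "dH z x \<le> ereal M" using z by (simp add: dH_sym)
        have z's: "dH z' s \<le> ereal M" using z' by (simp add: dH_sym)
        have "gdist x s \<le> ereal l" using gdist_le_cost[OF r2] by (simp add: l_def gdist_sym)
        then have "gdist z z' \<le> ereal (M + (l + M))"
          using zx z'(2) by (blast intro: gdist_trans order_trans[OF gdist_le_dH])
        from hub[OF z(1) z'(1) this] show ?thesis
        proof
          assume "dH z z' \<le> ereal (M + (l + M))"
          from dH_trans[OF ux dH_trans[OF z(2) dH_trans[OF this dH_trans[OF z's sv]]]]
          have "dH u v \<le> ereal (\<alpha> * awalk_cost w p1 + B + (M + (M + (l + M) + (M + (\<alpha> * awalk_cost w r1 + B)))))" .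
          then have "dH u v \<le> ereal (\<alpha> * c + 2 * B + 4 * M)"
            by (rule order_trans) (use \<open>l \<le> \<alpha> * l\<close> in \<open>simp add: c' l_def algebra_simps\<close>)
          then show ?thesis ..
        next
          assume "\<exists>h\<in>A (Suc (Suc i)). dH z h \<le> ereal (M + (l + M))"
          then obtain h where h: "h \<in> A (Suc (Suc i))" "dH z h \<le> ereal (M + (l + M))" by blast
          have "0 \<le> \<alpha> * awalk_cost w r1"
            using \<open>1 \<le> \<alpha>\<close> cost_nonneg[OF r1] by simp
          from dH_trans[OF ux dH_trans[OF z(2) h(2)]]
          have "dH u h \<le> ereal (\<alpha> * c + 2 * B + 3 * M)"
            by (rule order_trans)
              (use \<open>l \<le> \<alpha> * l\<close> \<open>0 \<le> B\<close> \<open>0 \<le> \<alpha> * awalk_cost w r1\<close> in \<open>simp add: c' l_def algebra_simps\<close>)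
          then show ?thesis using h(1) by blast
        qed
      qed
    qed
  qed
  ultimately show "dH u v \<le> ereal ((\<alpha> + 4 * \<gamma> / real n) * awalk_cost w p +
        (2 * (real n + 1) * \<beta> + 4 * (\<gamma> * W + \<zeta>))) \<or>
      (\<exists>h\<in>A (Suc (Suc i)). dH u h \<le> ereal ((\<alpha> + 3 * \<gamma> / real n) * awalk_cost w p +
        (2 * (real n + 1) * \<beta> + 3 * (\<gamma> * W + \<zeta>))))"
    by (simp only: c_def)
qed

text \<open>The hub factor stays at most 2 because \<open>8 * i \<le> n\<close>, so each level adds
  \<open>4 * 2 / n\<close> to \<alpha>. As \<open>W \<le> \<beta>\<close>, the additive term becomes
  at most \<open>2 * (n + 1) * \<beta> + 4 * (2 * W + \<beta>) \<le> (2 * n + 14) *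
  \<beta>\<close>.\<close>

lemma stretch_or_hub_level:
  assumes "0 < n" "8 * i \<le> n" "0 \<le> W"
  shows "stretch_or_hub i W (1 + 8 * real i / real n) ((2 * real n + 14) ^ i * W)
    2 ((2 * real n + 14) ^ i * W)"
  using assms(2)
proof (induct i)
  case 0
  show ?case
    by (rule stretch_or_hub_mono[OF stretch_or_hub_0]) (use \<open>0 \<le> W\<close> in auto)
next
  case (Suc i)
  define T where "T = 2 * real n + 14"
  define \<beta> where "\<beta> = T ^ i * W"
  have "1 \<le> T ^ i" by (simp add: T_def)
  then have "W \<le> \<beta>" unfolding \<beta>_def using \<open>0 \<le> W\<close> by (simp add: mult_le_cancel_right1)
  then have "0 \<le> \<beta>" using \<open>0 \<le> W\<close> by simp
  have T_Suc: "T ^ Suc i * W = 2 * (real n + 1) * \<beta> + 12 * \<beta>"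
    by (simp add: \<beta>_def T_def algebra_simps)
  have "8 * (real i + 1) \<le> real n"
    using of_nat_mono[OF Suc.prems, where 'a = real] by simp
  then have \<gamma>: "1 + 8 * real i / real n + 3 * 2 / real n \<le> 2"
    using \<open>0 < n\<close> by (simp add: field_simps)
  have "stretch_or_hub i W (1 + 8 * real i / real n) \<beta> 2 \<beta>"
    using Suc unfolding \<beta>_def T_def by simp
  from stretch_or_hub_Suc[OF this \<open>0 < n\<close> \<open>0 \<le> W\<close> _ \<open>0 \<le> \<beta>\<close> _ \<open>0 \<le> \<beta>\<close>]
  show ?case
    unfolding T_def[symmetric] T_Suc
    by (rule stretch_or_hub_mono)
      (use \<gamma> \<open>W \<le> \<beta>\<close> \<open>0 \<le> \<beta>\<close> in \<open>auto simp: add_divide_distrib algebra_simps\<close>)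
qed

text \<open>At level \<open>k - 1\<close> the hub alternative asks for an element of the empty set
  \<open>A k\<close>, so only the stretch alternative remains.\<close>

lemma dH_le_stretch:
  assumes "A k = {}" "0 < k" "0 < \<epsilon>" "\<epsilon> < 1"
    and walk: "awalk u p v" and light: "\<forall>e\<in>set p. w e \<le> W" and "0 \<le> W"
  shows "dH u v \<le> ereal ((1 + \<epsilon>) * awalk_cost w p + (32 * real k / \<epsilon>) ^ (k - 1) * W)"
proof -
  \<comment> \<open>Large enough for \<open>8 * (k - 1) / n \<le> \<epsilon>\<close>, and small
    enough for \<open>2 * n + 14 \<le> 16 * k / \<epsilon> + 16 \<le> 32 * k /
    \<epsilon>\<close>.\<close>
  define n where "n = nat \<lceil>8 * real k / \<epsilon>\<rceil>"
  have "1 \<le> real k" using \<open>0 < k\<close> by simp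
  then have k_le: "real k \<le> real k / \<epsilon>" "1 \<le> real k / \<epsilon>"
    using assms(3,4) by (simp_all add: field_simps mult_le_cancel_right1)
  have n_ge: "8 * real k / \<epsilon> \<le> real n" unfolding n_def by linarith
  have n_le: "real n \<le> 8 * real k / \<epsilon> + 1" unfolding n_def using k_le by linarith
  have "8 * real k \<le> real n" "0 < n" using n_ge k_le by linarith+
  then have "8 * (k - 1) \<le> n" by linarith
  have "8 * real (k - 1) \<le> \<epsilon> * real n"
    using n_ge assms(3) \<open>0 < k\<close> by (simp add: field_simps of_nat_diff)
  then have "8 * real (k - 1) / real n \<le> \<epsilon>"
    using \<open>0 < n\<close> by (simp add: field_simps)
  moreover have "(2 * real n + 14) ^ (k - 1) * W \<le> (32 * real k / \<epsilon>) ^ (k - 1) * W"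
    using n_le k_le \<open>0 \<le> W\<close> by (intro mult_right_mono power_mono) auto
  moreover have "stretch_or_hub (k - 1) W (1 + 8 * real (k - 1) / real n)
      ((2 * real n + 14) ^ (k - 1) * W) 2 ((2 * real n + 14) ^ (k - 1) * W)"
    using stretch_or_hub_level \<open>0 < n\<close> \<open>8 * (k - 1) \<le> n\<close> \<open>0 \<le> W\<close> by blast
  ultimately have "stretch_or_hub (k - 1) W (1 + \<epsilon>) ((32 * real k / \<epsilon>) ^ (k - 1) * W)
      2 ((2 * real n + 14) ^ (k - 1) * W)"
    using stretch_or_hub_mono by simp
  then show ?thesis
    using assms unfolding stretch_or_hub_def by auto
qed

end

subsection \<open>The emulator\<close>

lemma exists_sampling_hierarchy:
  fixes f :: "'a \<Rightarrow> 'a \<Rightarrow> 'b :: linorder"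
  assumes "finite V" "0 < k"
  shows "\<exists>A. A 0 = V \<and> (\<forall>i. A (Suc i) \<subseteq> A i) \<and> A k = {} \<and>
    real (\<Sum>i<k. \<Sum>u\<in>A i. card {v \<in> A i. \<forall>a\<in>A (Suc i). f u v < f u a})
      \<le> 4 * real (card V) powr (1 + 1 / (2 ^ k - 1))"
proof (cases "V = {}")
  case True
  then show ?thesis by (intro exI[of _ "\<lambda>_. {}"]) simp
next
  case False
  define n where "n = real (card V)"
  define \<nu> :: real where "\<nu> = 1 / (2 ^ k - 1)"
  \<comment> \<open>Twice the exponent at \<open>i\<close> minus the one at \<open>Suc i\<close> is
    always \<open>1 + \<nu>\<close>, and the exponent at \<open>k\<close> is 0. The factor
    \<open>1 / 2 ^ i\<close> makes the level sizes sum geometrically and forces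
    \<open>N k < 1\<close>, hence \<open>A k = {}\<close>.\<close>
  define N :: "nat \<Rightarrow> real" where "N i = n powr (1 - (2 ^ i - 1) * \<nu>) / 2 ^ i" for i
  define B where "B X Y = (\<Sum>u\<in>X. card {v \<in> X. \<forall>a\<in>Y. f u v < f u a})" for X Y
  have "0 < n" using False assms by (simp add: n_def card_gt_0_iff)
  then have N_pos: "0 < N i" for i by (simp add: N_def)
  have "\<exists>A. \<forall>i. ((i = 0 \<longrightarrow> A i = V) \<and> finite (A i) \<and> real (card (A i)) \<le> N i) \<and>
      A (Suc i) \<subseteq> A i \<and> real (B (A i) (A (Suc i))) \<le> (real (card (A i)))\<^sup>2 / N (Suc i)"
  proof (rule dependent_nat_choice)
    show "\<exists>x. (0 = (0::nat) \<longrightarrow> x = V) \<and> finite x \<and> real (card x) \<le> N 0"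
      using assms \<open>0 < n\<close> by (auto simp: N_def n_def)
  next
    fix x i
    assume "(i = 0 \<longrightarrow> x = V) \<and> finite x \<and> real (card x) \<le> N i"
    then have "finite x" by blast
    from exists_subset_few_strictly_closer[OF this N_pos[of "Suc i"], of f]
    show "\<exists>y. ((Suc i = 0 \<longrightarrow> y = V) \<and> finite y \<and> real (card y) \<le> N (Suc i)) \<and>
        y \<subseteq> x \<and> real (B x y) \<le> (real (card x))\<^sup>2 / N (Suc i)"
      using \<open>finite x\<close> unfolding B_def by (auto intro: finite_subset)
  qed
  then obtain A where A0: "A 0 = V" and fin: "\<And>i. finite (A i)" and size: "\<And>i. real (card (A i)) \<le> N i"
    and sub: "\<And>i. A (Suc i) \<subseteq> A i"
    and few: "\<And>i. real (B (A i) (A (Suc i))) \<le> (real (card (A i)))\<^sup>2 / N (Suc i)"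
    by metis
  have "(1::real) < 2 ^ k" using \<open>0 < k\<close> by simp
  then have "N k = 1 / 2 ^ k" using \<open>0 < n\<close> by (simp add: N_def \<nu>_def)
  also have "\<dots> < 1" using \<open>(1::real) < 2 ^ k\<close> by simp
  finally have "card (A k) = 0" using size[of k] by linarith
  then have "A k = {}" using fin by simp
  have ratio: "(N i)\<^sup>2 / N (Suc i) = n powr (1 + \<nu>) * (2 / 2 ^ i)" for i
  proof -
    have "(N i)\<^sup>2 = n powr (2 * (1 - (2 ^ i - 1) * \<nu>)) / (2 ^ i)\<^sup>2"
      using \<open>0 < n\<close> by (simp add: N_def power_divide powr_power algebra_simps)
    then have "(N i)\<^sup>2 / N (Suc i) =
        n powr (2 * (1 - (2 ^ i - 1) * \<nu>)) / n powr (1 - (2 ^ Suc i - 1) * \<nu>) * (2 ^ Suc i / (2 ^ i)\<^sup>2)"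
      by (simp add: N_def)
    also have "n powr (2 * (1 - (2 ^ i - 1) * \<nu>)) / n powr (1 - (2 ^ Suc i - 1) * \<nu>) = n powr (1 + \<nu>)"
      by (simp add: algebra_simps flip: powr_diff)
    also have "(2::real) ^ Suc i / (2 ^ i)\<^sup>2 = 2 / 2 ^ i"
      by (simp add: power2_eq_square)
    finally show ?thesis .
  qed
  have "real (B (A i) (A (Suc i))) \<le> n powr (1 + \<nu>) * (2 / 2 ^ i)" for i
  proof -
    have "(real (card (A i)))\<^sup>2 / N (Suc i) \<le> (N i)\<^sup>2 / N (Suc i)"
      using size N_pos[of "Suc i"] by (intro divide_right_mono power_mono) auto
    then show ?thesis using few[of i] ratio by simp
  qed
  then have "(\<Sum>i<k. real (B (A i) (A (Suc i)))) \<le> (\<Sum>i<k. n powr (1 + \<nu>) * (2 / 2 ^ i))"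
    by (intro sum_mono)
  also have "\<dots> = n powr (1 + \<nu>) * (\<Sum>i<k. 2 / 2 ^ i)" by (simp only: sum_distrib_left)
  also have "(\<Sum>i<k. 2 / 2 ^ i) = 4 - 4 / (2::real) ^ k" by (induct k) (auto simp: field_simps)
  also have "n powr (1 + \<nu>) * (4 - 4 / 2 ^ k) \<le> n powr (1 + \<nu>) * 4"
    by (intro mult_left_mono) auto
  finally show ?thesis
    using A0 sub \<open>A k = {}\<close> unfolding B_def n_def \<nu>_def by (intro exI[of _ A]) (simp add: mult.commute)
qed

text \<open>The pairs in \<open>near\<close> give the sampled edges, and the pivots add at most one
  pair per vertex and level, which is the \<open>k * n\<close> term.\<close>

lemma (in weighted_pair_graph) exists_hub_hierarchy:
  assumes "0 < k"
  shows "\<exists>X A. finite X \<and>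
    real (card X) \<le> 4 * (real k * real (card (pverts G)) +
      real (card (pverts G)) powr (1 + 1 / (2 ^ k - 1))) \<and>
    A k = {} \<and>
    hub_hierarchy G w (graph_dist (distance_graph G w X) (distance_weight G w)) A"
proof -
  obtain A where A0: "A 0 = pverts G" and sub: "\<And>i. A (Suc i) \<subseteq> A i" and Ak: "A k = {}"
    and few: "real (\<Sum>i<k. \<Sum>u\<in>A i. card {v \<in> A i. \<forall>a\<in>A (Suc i). gdist u v < gdist u a})
      \<le> 4 * real (card (pverts G)) powr (1 + 1 / (2 ^ k - 1))"
    using exists_sampling_hierarchy[OF pair_finite_verts assms, of gdist] by blast
  have anti: "antimono A" using sub by (intro decseq_SucI)
  then have A_verts: "A i \<subseteq> pverts G" for i using antimonoD[OF anti, of 0 i] A0 by simp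
  then have fin: "finite (A i)" for i using finite_subset pair_finite_verts by blast
  define near where "near i u = {v \<in> A i. \<forall>a\<in>A (Suc i). gdist u v < gdist u a}" for i u
  \<comment> \<open>For empty \<open>A (Suc i)\<close> the value is arbitrary; such a pair is still
    covered by the count, and an edge of exact weight cannot shorten distances.\<close>
  define pivot where "pivot i u = arg_min_on (gdist u) (A (Suc i))" for i u
  define X where "X = (\<Union>i<k. SIGMA u : A i. near i u) \<union> (\<Union>i<k. (\<lambda>u. (u, pivot i u)) ` pverts G)"
  have fin_near: "finite (near i u)" for i u using fin by (simp add: near_def)
  have "finite X" unfolding X_def using fin fin_near pair_finite_verts by auto
  have "card (\<Union>i<k. SIGMA u : A i. near i u) \<le> (\<Sum>i<k. card (SIGMA u : A i. near i u))"
    by (rule card_UN_le) simp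
  also have "\<dots> = (\<Sum>i<k. \<Sum>u\<in>A i. card (near i u))"
    using fin fin_near by simp
  finally have card1: "card (\<Union>i<k. SIGMA u : A i. near i u) \<le> (\<Sum>i<k. \<Sum>u\<in>A i. card (near i u))" .
  have "card (\<Union>i<k. (\<lambda>u. (u, pivot i u)) ` pverts G) \<le>
      (\<Sum>i<k. card ((\<lambda>u. (u, pivot i u)) ` pverts G))"
    by (rule card_UN_le) simp
  also have "\<dots> \<le> (\<Sum>i<k. card (pverts G))"
    using pair_finite_verts by (intro sum_mono card_image_le)
  finally have card2: "card (\<Union>i<k. (\<lambda>u. (u, pivot i u)) ` pverts G) \<le> k * card (pverts G)" by simp
  have "card X \<le> (\<Sum>i<k. \<Sum>u\<in>A i. card (near i u)) + k * card (pverts G)"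
    unfolding X_def by (rule order_trans[OF card_Un_le add_mono[OF card1 card2]])
  then have "real (card X) \<le> real ((\<Sum>i<k. \<Sum>u\<in>A i. card (near i u)) + k * card (pverts G))"
    by (rule of_nat_mono)
  then have "real (card X) \<le> real (\<Sum>i<k. \<Sum>u\<in>A i. card (near i u)) + real k * real (card (pverts G))"
    by simp
  also have "\<dots> \<le> 4 * real (card (pverts G)) powr (1 + 1 / (2 ^ k - 1)) +
      4 * (real k * real (card (pverts G)))"
    using few unfolding near_def by (intro add_mono) auto
  finally have card_X: "real (card X) \<le> 4 * (real k * real (card (pverts G)) +
      real (card (pverts G)) powr (1 + 1 / (2 ^ k - 1)))"
    by (simp add: algebra_simps)
  interpret H: weighted_pair_graph "distance_graph G w X" "distance_weight G w"
    by (rule weighted_pair_graph_distance_graph)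
  have "hub_hierarchy G w H.gdist A"
  proof
    fix j z z' r
    assume z: "z \<in> A j" "z' \<in> A j" and r: "gdist z z' \<le> ereal r"
    have "j < k"
    proof (rule ccontr)
      assume "\<not> j < k"
      then show False using antimonoD[OF anti, of k j] z Ak by auto
    qed
    have verts: "z \<in> pverts G" "z' \<in> pverts G" using z A_verts by auto
    show "H.gdist z z' \<le> ereal r \<or> (\<exists>h\<in>A (Suc j). H.gdist z h \<le> ereal r)"
    proof (cases "z' \<in> near j z")
      case True
      then have "(z, z') \<in> X" using z \<open>j < k\<close> by (auto simp: X_def)
      from distance_graph_le_gdist[OF verts this] r show ?thesis by (auto intro: order_trans)
    next
      case False
      \<comment> \<open>A failure of \<open>near\<close> itself yields a hub of the next level, so
        \<open>A (Suc j)\<close> is nonempty and the pivot is a true minimiser. At the top level all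
        pairs are near.\<close>
      then obtain a where a: "a \<in> A (Suc j)" "gdist z a \<le> gdist z z'"
        using z by (auto simp: near_def not_less)
      then have "A (Suc j) \<noteq> {}" by blast
      have pivot: "pivot j z \<in> A (Suc j)" "gdist z (pivot j z) \<le> gdist z a"
        unfolding pivot_def
        using arg_min_if_finite(1)[OF fin \<open>A (Suc j) \<noteq> {}\<close>]
          arg_min_least[OF fin \<open>A (Suc j) \<noteq> {}\<close> a(1)] by auto
      have "(z, pivot j z) \<in> X" using verts \<open>j < k\<close> by (auto simp: X_def)
      with verts pivot(1) A_verts have "H.gdist z (pivot j z) \<le> gdist z (pivot j z)"
        by (intro distance_graph_le_gdist) auto
      with pivot a(2) r show ?thesis by (meson order_trans)
    qed
  qed (rule H.gdist_sym H.gdist_triangle | simp add: A0 H.gdist_self gdist_le_distance_graph)+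
  with \<open>finite X\<close> card_X Ak show ?thesis by blast
qed

theorem theorem3p3:
  "\<exists>C\<^sub>1 > 0. \<exists>C > 0. \<forall>(G :: 'a pair_pre_digraph) (w :: ('a \<times> 'a) weight_fun) (k :: nat).
     weighted_graph G w \<longrightarrow> k > 1 \<longrightarrow>
     (\<exists>(H :: 'a pair_pre_digraph) (wH :: ('a \<times> 'a) weight_fun).
        weighted_graph H wH \<and> pverts H = pverts G \<and>
        real (card (undirected_edges H)) \<le>
          C\<^sub>1 * (real k * real (card (pverts G)) +
                real (card (pverts G)) powr (1 + 1 / (2 ^ k - 1))) \<and>
        (\<forall>\<epsilon> :: real. 0 < \<epsilon> \<and> \<epsilon> < 1 \<longrightarrow>
           (\<exists>\<beta> :: real. \<beta> \<le> (C * real k / \<epsilon>) ^ (k - 1) \<and>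
              (\<forall>P. shortest_path_choice G w P \<longrightarrow>
                 is_emulator (1 + \<epsilon>) (\<lambda>x y. \<beta> * max_edge_weight w P x y) G w H wH))))"
proof (rule exI[of _ 4], intro conjI, simp, rule exI[of _ 32], intro conjI allI impI, simp)
  fix G :: "'a pair_pre_digraph" and w :: "('a \<times> 'a) weight_fun" and k :: nat
  assume "weighted_graph G w" "1 < k"
  then interpret weighted_pair_graph G w by (simp add: weighted_graph_iff)
  from \<open>1 < k\<close> have "0 < k" by simp
  from exists_hub_hierarchy[OF this] obtain X A where "finite X"
    and card_X: "real (card X) \<le> 4 * (real k * real (card (pverts G)) +
      real (card (pverts G)) powr (1 + 1 / (2 ^ k - 1)))"
    and "A k = {}"
    and hier: "hub_hierarchy G w (graph_dist (distance_graph G w X) (distance_weight G w)) A"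
    by blast
  define H where "H = distance_graph G w X"
  define wH where "wH = distance_weight G w"
  interpret hub_hierarchy G w "graph_dist H wH" A using hier unfolding H_def wH_def .
  have H: "weighted_graph H wH" "pverts H = pverts G"
    unfolding H_def wH_def weighted_graph_iff
    using weighted_pair_graph_distance_graph by auto
  have edges: "real (card (undirected_edges H)) \<le> 4 * (real k * real (card (pverts G)) +
      real (card (pverts G)) powr (1 + 1 / (2 ^ k - 1)))"
    using card_undirected_edges_distance_graph[OF \<open>finite X\<close>, of G w] card_X unfolding H_def by linarith
  \<comment> \<open>The permitted bound itself serves as \<beta>. For each connected pair, the
    stretch lemma is applied to the chosen path \<open>P x y\<close>, with \<open>W\<close> its own
    maximal edge weight.\<close>
  have "is_emulator (1 + \<epsilon>) (\<lambda>x y. (32 * real k / \<epsilon>) ^ (k - 1) * max_edge_weight w P x y) G w H wH"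
    if \<epsilon>: "0 < \<epsilon>" "\<epsilon> < 1" and P: "shortest_path_choice G w P" for \<epsilon> P
  proof -
    have "graph_dist H wH x y \<le> ereal (1 + \<epsilon>) * gdist x y +
        ereal ((32 * real k / \<epsilon>) ^ (k - 1) * max_edge_weight w P x y)"
      if "x \<in> pverts G" "y \<in> pverts G" for x y
    proof (cases "gdist x y = \<infinity>")
      case True
      then show ?thesis using \<epsilon> by simp
    next
      case False
      then have "x \<rightarrow>\<^sup>*\<^bsub>with_proj G\<^esub> y"
        using \<mu>_reach_conv[of w x y] unfolding graph_dist_def by simp
      then have path: "awalk x (P x y) y" "ereal (awalk_cost w (P x y)) = gdist x y"
        using P that unfolding shortest_path_choice_def shortest_path_def by (auto simp: apath_def)
      have light: "\<forall>e\<in>set (P x y). w e \<le> max_edge_weight w P x y" "0 \<le> max_edge_weight w P x y"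
        unfolding max_edge_weight_def by auto
      show ?thesis
        using dH_le_stretch[OF \<open>A k = {}\<close> \<open>0 < k\<close> \<epsilon> path(1) light] by (simp flip: path(2))
    qed
    then show ?thesis
      unfolding is_emulator_def using H gdist_le_dH by blast
  qed
  with H edges show "\<exists>(H :: 'a pair_pre_digraph) (wH :: ('a \<times> 'a) weight_fun).
      weighted_graph H wH \<and> pverts H = pverts G \<and>
      real (card (undirected_edges H)) \<le>
        4 * (real k * real (card (pverts G)) +
          real (card (pverts G)) powr (1 + 1 / (2 ^ k - 1))) \<and>
      (\<forall>\<epsilon> :: real. 0 < \<epsilon> \<and> \<epsilon> < 1 \<longrightarrow>
         (\<exists>\<beta> :: real. \<beta> \<le> (32 * real k / \<epsilon>) ^ (k - 1) \<and>
            (\<forall>P. shortest_path_choice G w P \<longrightarrow>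
               is_emulator (1 + \<epsilon>) (\<lambda>x y. \<beta> * max_edge_weight w P x y) G w H wH)))"
    by (intro exI[of _ H] exI[of _ wH]) blast
qed

end
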